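(* Let $F$ be a field of characteristic $p>0$, complete with respect to a non-Archimedean norm $|\cdot|_F$, and let $(\mathcal{U},\mathbf{eval})$ be an umbral calculus on $F[[T]]$. Let $\mathcal{F},\widehat{\mathcal{F}}:F\to\mathcal{U}$ be umbral maps such that the flow map $\mathcal{D}_{\mathcal{F}}$ is a dual of $\mathcal{D}_{\widehat{\mathcal{F}}}$, via an additive isomorphism $\phi$ with $\mathcal{D}_{\widehat{\mathcal{F}}}(x)=\phi\circ\mathcal{D}_{\mathcal{F}}(x)\circ\phi^{-1}$ for all $x\in\mathcal{A}_{\mathcal{F}}\cap\mathcal{A}_{\widehat{\mathcal{F}}}$ (so that $\widehat{\mathcal{F}}_k(x)=\mathbf{eval}(H^{(-1)}(\mathcal{F}(x))^k)$ for all $k\ge0$ and such $x$, where $H=\phi(T)$). Let $\mathcal{A}_{\widehat{\mathcal{F}}_1}=\{x\in F:|\widehat{\mathcal{F}}_1(x)|_F<1\}$ and let $x\in\mathcal{A}_{\mathcal{F}}\cap\mathcal{A}_{\widehat{\mathcal{F}}}\cap\mathcal{A}_{\widehat{\mathcal{F}}_1}$. Then the operator $e^{\widehat{\mathcal{F}}_1(x)\mathbf{D}}$ is equal to $\mathcal{D}_{\widehat{\mathcal{F}}}(x)$ if and only if $\mathcal{F}$ is geometric at $x$.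
   Context: An umbral calculus on $F[[T]]$ is a pair $(\mathcal{U},\mathbf{eval})$ where $\mathcal{U}$ is a set of indeterminates called umbrae and $\mathbf{eval}:F[[T]][\mathcal{U}]\to F[[T]]$ is a linear map (over $F[[T]]$) with $\mathbf{eval}(1)=1$, $\mathbf{eval}(\alpha^n)\in F$ for every umbra $\alpha$, $n\ge0$, and $\mathbf{eval}(\alpha_1^{n_1}\cdots\alpha_m^{n_m})=\prod_i\mathbf{eval}(\alpha_i^{n_i})$ for distinct umbrae; $\mathbf{eval}$ is extended termwise to power series in finitely many umbrae whenever the resulting series in $F$ converge coefficientwise in $T$. $F_b[[T]]$ is the algebra of bounded power series $\sum a_mT^m$ (there is $c$ with $|a_m|_F<c$ for all $m$). $\mathbf{D}^{(k)}$ is the $k$-th Hasse derivative: $\mathbf{D}^{(k)}T^n=\binom nkT^{n-k}$ for $n\ge k$, $0$ otherwise. An umbral map is a map $\mathcal{F}:F\to\mathcal{U}$; $\mathcal{F}_k(x):=\mathbf{eval}(\mathcal{F}(x)^k)$; $\mathcal{A}_{\mathcal{F}}=\{x\in F:\mathcal{F}_k(x)\to0\}$; for $x\in\mathcal{A}_{\mathcal{F}}$, $\mathcal{D}_{\mathcal{F}}(x)=\sum_{k\ge0}\mathcal{F}_k(x)\mathbf{D}^{(k)}$ acting on $F_b[[T]]$. For $c\in F$ with $|c|_F<1$, $e^{c\mathbf{D}}:=\sum_{k\ge0}c^k\mathbf{D}^{(k)}$ on $F_b[[T]]$. $\mathcal{F}$ is geometric at $x$ if $\mathcal{F}_k(x)=\mathcal{F}_1(x)^k$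 for all $k\ge0$. With $\mathcal{O}_F=\{|x|_F\le1\}$, an algebra isomorphism $\phi:F[[T]]\to F[[T]]$, $\phi(P(T))=P(H(T))$, is additive if $H=\phi(T)$ is bounded, involves only powers $T^{p^m}$, and its coefficient of $T$ (i.e. $\mathbf{D}(H)$) lies in $\mathcal{O}_F^\times$; $H^{(-1)}$ denotes the composition inverse of $H$. $\mathcal{D}_{\mathcal{F}}$ is a dual of $\mathcal{D}_{\widehat{\mathcal{F}}}$ if some additive isomorphism $\phi$ satisfies $\phi\circ\mathcal{D}_{\mathcal{F}}(x)=\mathcal{D}_{\widehat{\mathcal{F}}}(x)\circ\phi$ on $F_b[[T]]$ for all $x\in\mathcal{A}_{\mathcal{F}}\cap\mathcal{A}_{\widehat{\mathcal{F}}}$.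
   Formalization: Duality is taken to include that φ maps F_b[[T]] into itself, which is needed for D_F̂(x)∘φ to be defined on F_b[[T]]; boundedness of H alone does not ensure it (e.g. H = T + cT^p with |c| > 1 sends 1/(1−T) to an unbounded series). *)

theory Defs
  imports
    Complex_Main
    "HOL-Library.Poly_Mapping"
    "HOL-Computational_Algebra.Computational_Algebra"
begin

text \<open>
  Fields with a multiplicative non-Archimedean norm \<open>vnorm\<close>, as metric spaces with the induced
  metric.  The library norm cannot be used: \<open>norm\<close> is constrained to real vector spaces, which
  excludes positive characteristic.  Completeness is expressed by additionally requiring the
  library class \<open>complete_space\<close>.
\<close>

class nonarch_normed_field = field + metric_space +
  fixes vnorm :: "'a \<Rightarrow> real"
  assumes vnorm_nonneg: "0 \<le> vnorm x"
    and vnorm_eq_zero: "vnorm x = 0 \<longleftrightarrow> x = 0"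
    and vnorm_mult: "vnorm (x * y) = vnorm x * vnorm y"
    and vnorm_add: "vnorm (x + y) \<le> max (vnorm x) (vnorm y)"
    and dist_vnorm: "dist x y = vnorm (x - y)"

definition integer_ring :: "'a::nonarch_normed_field set" where
  "integer_ring = {x. vnorm x \<le> 1}"

definition integer_units :: "'a::nonarch_normed_field set" where
  "integer_units = {x \<in> integer_ring. \<exists>y \<in> integer_ring. x * y = 1}"

definition bounded_fps :: "'a::nonarch_normed_field fps set" where
  "bounded_fps = {P. \<exists>c. \<forall>m. vnorm (fps_nth P m) < c}"

definition hasse_deriv :: "nat \<Rightarrow> 'a::comm_ring_1 fps \<Rightarrow> 'a fps" where
  "hasse_deriv k P = Abs_fps (\<lambda>n. of_nat ((n + k) choose k) * fps_nth P (n + k))"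

lemma hasse_deriv_X_power:
  "hasse_deriv k (fps_X ^ n :: 'a::comm_ring_1 fps) =
     (if k \<le> n then of_nat (n choose k) * fps_X ^ (n - k) else 0)"
  by (rule fps_ext) (auto simp: hasse_deriv_def fps_X_power_nth fps_mult_of_nat_nth)

text \<open>
  The operator \<open>\<Sum>k. a k * D^(k)\<close>.  The sum is taken coefficientwise in the topology of the
  coefficient field; it converges on bounded series whenever \<open>a\<close> tends to 0.
\<close>

definition hasse_series :: "(nat \<Rightarrow> 'a::nonarch_normed_field) \<Rightarrow> 'a fps \<Rightarrow> 'a fps" where
  "hasse_series a P = Abs_fps (\<lambda>n. suminf (\<lambda>k. a k * fps_nth (hasse_deriv k P) n))"

definition exp_hasse :: "'a::nonarch_normed_field \<Rightarrow> 'a fps \<Rightarrow> 'a fps" where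
  "exp_hasse c = hasse_series (\<lambda>k. c ^ k)"

text \<open>
  Polynomials over \<open>F[[T]]\<close> in the umbrae: the outer map sends a monomial (its exponent map) to
  its coefficient.  The set of umbrae is the type \<open>'u\<close>.
\<close>

type_synonym ('u, 'a) umbral_poly = "('u \<Rightarrow>\<^sub>0 nat) \<Rightarrow>\<^sub>0 'a fps"

definition umbra :: "'u \<Rightarrow> ('u, 'a::field) umbral_poly" where
  "umbra \<alpha> = Poly_Mapping.single (Poly_Mapping.single \<alpha> 1) 1"

definition umbral_const :: "'a::field fps \<Rightarrow> ('u, 'a) umbral_poly" where
  "umbral_const c = Poly_Mapping.single 0 c"

definition umbral_calculus :: "(('u, 'a::field) umbral_poly \<Rightarrow> 'a fps) \<Rightarrow> bool" where
  "umbral_calculus ev \<longleftrightarrow>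
     (\<forall>f g. ev (f + g) = ev f + ev g) \<and>
     (\<forall>c f. ev (umbral_const c * f) = c * ev f) \<and>
     ev 1 = 1 \<and>
     (\<forall>\<alpha> n. ev (umbra \<alpha> ^ n) \<in> range fps_const) \<and>
     (\<forall>S n. finite S \<longrightarrow>
        ev (\<Prod>\<alpha>\<in>S. umbra \<alpha> ^ n \<alpha>) = (\<Prod>\<alpha>\<in>S. ev (umbra \<alpha> ^ n \<alpha>)))"

text \<open>
  The value of \<open>ev\<close> on a power of an umbra is a constant series, so taking the constant
  coefficient just views it as an element of the field.
\<close>

definition umbral_moment ::
    "(('u, 'a::field) umbral_poly \<Rightarrow> 'a fps) \<Rightarrow> ('a \<Rightarrow> 'u) \<Rightarrow> nat \<Rightarrow> 'a \<Rightarrow> 'a" where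
  "umbral_moment ev \<F> k x = fps_nth (ev (umbra (\<F> x) ^ k)) 0"

definition flow_domain ::
    "(('u, 'a::nonarch_normed_field) umbral_poly \<Rightarrow> 'a fps) \<Rightarrow> ('a \<Rightarrow> 'u) \<Rightarrow> 'a set" where
  "flow_domain ev \<F> = {x. (\<lambda>k. umbral_moment ev \<F> k x) \<longlonglongrightarrow> 0}"

definition flow_map ::
    "(('u, 'a::nonarch_normed_field) umbral_poly \<Rightarrow> 'a fps) \<Rightarrow> ('a \<Rightarrow> 'u) \<Rightarrow>
     'a \<Rightarrow> 'a fps \<Rightarrow> 'a fps" where
  "flow_map ev \<F> x = hasse_series (\<lambda>k. umbral_moment ev \<F> k x)"

definition geometric_at ::
    "(('u, 'a::field) umbral_poly \<Rightarrow> 'a fps) \<Rightarrow> ('a \<Rightarrow> 'u) \<Rightarrow> 'a \<Rightarrow> bool" where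
  "geometric_at ev \<F> x \<longleftrightarrow> (\<forall>k. umbral_moment ev \<F> k x = umbral_moment ev \<F> 1 x ^ k)"

definition fps_algebra_iso :: "('a::field fps \<Rightarrow> 'a fps) \<Rightarrow> bool" where
  "fps_algebra_iso \<phi> \<longleftrightarrow> bij \<phi> \<and>
     (\<forall>P Q. \<phi> (P + Q) = \<phi> P + \<phi> Q) \<and>
     (\<forall>P Q. \<phi> (P * Q) = \<phi> P * \<phi> Q) \<and>
     (\<forall>c. \<phi> (fps_const c) = fps_const c)"

definition additive_iso :: "('a::nonarch_normed_field fps \<Rightarrow> 'a fps) \<Rightarrow> bool" where
  "additive_iso \<phi> \<longleftrightarrow> fps_algebra_iso \<phi> \<and>
     (\<forall>P. \<phi> P = P oo \<phi> fps_X) \<and>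
     \<phi> fps_X \<in> bounded_fps \<and>
     (\<forall>n. fps_nth (\<phi> fps_X) n \<noteq> 0 \<longrightarrow> (\<exists>m. n = CHAR('a) ^ m)) \<and>
     fps_nth (\<phi> fps_X) 1 \<in> integer_units"

text \<open>
  The flow maps are operators on \<open>bounded_fps\<close>, so the composite of the second flow map with
  \<open>\<phi>\<close> on \<open>bounded_fps\<close> makes sense only if \<open>\<phi>\<close> maps \<open>bounded_fps\<close> into itself.  Boundedness of
  \<open>\<phi> fps_X\<close> does not imply this: for \<open>\<phi> fps_X = T + c T^p\<close> with \<open>vnorm c > 1\<close>, the image of
  \<open>1 / (1 - T)\<close> is unbounded.  It is therefore stated as part of the intertwining relation.
\<close>

definition flow_dual_via ::
    "(('u, 'a::nonarch_normed_field) umbral_poly \<Rightarrow> 'a fps) \<Rightarrow> ('a fps \<Rightarrow> 'a fps) \<Rightarrow>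
     ('a \<Rightarrow> 'u) \<Rightarrow> ('a \<Rightarrow> 'u) \<Rightarrow> bool" where
  "flow_dual_via ev \<phi> \<F> \<G> \<longleftrightarrow> additive_iso \<phi> \<and>
     (\<forall>x \<in> flow_domain ev \<F> \<inter> flow_domain ev \<G>. \<forall>P \<in> bounded_fps.
        \<phi> P \<in> bounded_fps \<and> \<phi> (flow_map ev \<F> x P) = flow_map ev \<G> x (\<phi> P))"

end

theory Submission
  imports Defs
begin

text \<open>
  Write \<open>a\<close> and \<open>b\<close> for the moment sequences of \<open>\<F>\<close> and \<open>\<F>h\<close> at \<open>x\<close>.  Comparing constant
  coefficients in the intertwining relation gives \<open>\<Sum>k. a k * P k = \<Sum>k. b k * (\<phi> P) k\<close> for
  bounded \<open>P\<close>.  A moment sequence \<open>c ^ k\<close> with \<open>vnorm c < 1\<close> makes this functional the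
  evaluation at \<open>c\<close>, which is multiplicative; so if one of \<open>a\<close>, \<open>b\<close> is geometric, testing the
  identity on the powers of \<open>T\<close>, or on their preimages under \<open>\<phi>\<close>, shows that the other one is too.

  The preimages of the powers of \<open>T\<close> have to be bounded.  Since \<open>\<phi>\<close> preserves boundedness,
  \<open>1 - \<phi> T\<close> has the bounded inverse \<open>\<phi> (1 / (1 - T))\<close>, and multiplicativity of the Gauss norms of
  radius \<open>r < 1\<close> forces \<open>\<phi> T\<close> to have integral coefficients.  As its linear coefficient is a
  unit, \<open>\<phi>\<inverse>\<close> then preserves integrality.
\<close>

section \<open>Non-Archimedean norms\<close>

lemma vnorm_zero [simp]: "vnorm (0::'a::nonarch_normed_field) = 0"
  by (simp add: vnorm_eq_zero)

lemma vnorm_one [simp]: "vnorm (1::'a::nonarch_normed_field) = 1"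
proof -
  have "vnorm (1::'a) * vnorm (1::'a) = vnorm (1::'a)"
    using vnorm_mult[of "1::'a" 1] by simp
  moreover have "vnorm (1::'a) \<noteq> 0" by (simp add: vnorm_eq_zero)
  ultimately show ?thesis by simp
qed

lemma vnorm_minus [simp]: "vnorm (- x) = vnorm (x::'a::nonarch_normed_field)"
proof -
  have "vnorm (-1::'a) * vnorm (-1::'a) = 1"
    using vnorm_mult[of "-1::'a" "-1"] by simp
  then have "vnorm (-1::'a) = 1"
    using vnorm_nonneg[of "-1::'a"] by (auto simp: square_eq_1_iff)
  then show ?thesis
    using vnorm_mult[of "-1" x] by simp
qed

lemma vnorm_diff: "vnorm (x - y) \<le> max (vnorm x) (vnorm (y::'a::nonarch_normed_field))"
  using vnorm_add[of x "- y"] by simp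

lemma vnorm_power: "vnorm (x ^ n) = vnorm (x::'a::nonarch_normed_field) ^ n"
  by (induction n) (auto simp: vnorm_mult)

lemma vnorm_sum_le:
  fixes f :: "'b \<Rightarrow> 'a::nonarch_normed_field"
  assumes "\<And>i. i \<in> S \<Longrightarrow> vnorm (f i) \<le> C" "0 \<le> C"
  shows "vnorm (sum f S) \<le> C"
  using assms
proof (induction S rule: infinite_finite_induct)
  case (insert i S)
  then show ?case using vnorm_add[of "f i" "sum f S"] by fastforce
qed auto

lemma vnorm_sum_less:
  fixes f :: "'b \<Rightarrow> 'a::nonarch_normed_field"
  assumes "\<And>i. i \<in> S \<Longrightarrow> vnorm (f i) < C" "0 < C"
  shows "vnorm (sum f S) < C"
  using assms
proof (induction S rule: infinite_finite_induct)
  case (insert i S)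
  then have "vnorm (f i) < C" "vnorm (sum f S) < C" by auto
  then show ?case using vnorm_add[of "f i" "sum f S"] insert.hyps by simp
qed auto

text \<open>The lower bound comes from writing \<open>x = (x + y) - y\<close>: if
  \<open>vnorm (x + y)\<close> were smaller than \<open>vnorm x\<close>, this difference would be
  too small to be \<open>x\<close>.\<close>

lemma vnorm_add_dominant:
  fixes x y :: "'a::nonarch_normed_field"
  assumes "vnorm y < vnorm x"
  shows "vnorm (x + y) = vnorm x"
  using assms vnorm_add[of x y] vnorm_diff[of "x + y" y] by simp

lemma tendsto_vnorm_iff:
  "(f \<longlongrightarrow> (l::'a::nonarch_normed_field)) F \<longleftrightarrow> ((\<lambda>n. vnorm (f n - l)) \<longlongrightarrow> 0) F"
  by (subst tendsto_dist_iff) (simp add: dist_vnorm)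

lemma tendsto_vnorm_bound:
  fixes f :: "nat \<Rightarrow> 'a::nonarch_normed_field"
  assumes "\<And>n. vnorm (f n - l) \<le> g n" "g \<longlonglongrightarrow> 0"
  shows "f \<longlonglongrightarrow> l"
proof (rule iffD2[OF tendsto_vnorm_iff])
  show "(\<lambda>n. vnorm (f n - l)) \<longlonglongrightarrow> 0"
    by (rule tendsto_sandwich[OF _ _ tendsto_const assms(2)]) (auto simp: vnorm_nonneg assms(1))
qed

text \<open>By the ultrametric inequality a block of terms is no larger than its largest term, so
  terms tending to 0 already make the partial sums Cauchy; completeness does the rest.\<close>

lemma nonarch_summable:
  fixes f :: "nat \<Rightarrow> 'a::{nonarch_normed_field, complete_space}"
  assumes "f \<longlonglongrightarrow> 0"
  shows "summable f"
proof -
  have "Cauchy (\<lambda>n. sum f {..<n})"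
  proof (rule metric_CauchyI)
    fix e :: real assume e: "0 < e"
    obtain N where N: "\<And>n. n \<ge> N \<Longrightarrow> vnorm (f n) < e"
      using metric_LIMSEQ_D[OF assms e] by (auto simp: dist_vnorm)
    have *: "dist (sum f {..<n}) (sum f {..<m}) < e" if "N \<le> m" "m \<le> n" for m n
    proof -
      have "sum f {..<n} - sum f {..<m} = sum f {m..<n}"
        using that by (metis atLeast0LessThan sum_diff_nat_ivl zero_le)
      then show ?thesis
        unfolding dist_vnorm using that N e by (auto intro!: vnorm_sum_less)
    qed
    show "\<exists>M. \<forall>m\<ge>M. \<forall>n\<ge>M. dist (sum f {..<m}) (sum f {..<n}) < e"
    proof (intro exI allI impI)
      fix m n assume "N \<le> m" "N \<le> n"
      then show "dist (sum f {..<m}) (sum f {..<n}) < e"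
        using *[of m n] *[of n m] by (cases "m \<le> n") (auto simp: dist_commute)
    qed
  qed
  then show ?thesis
    by (simp add: Cauchy_convergent_iff summable_iff_convergent)
qed

text \<open>Continuity of multiplication is not a class axiom; it follows from multiplicativity of
  \<open>vnorm\<close> by expanding the product around \<open>(a, b)\<close>.\<close>

lemma nonarch_tendsto_mult:
  fixes f g :: "nat \<Rightarrow> 'a::nonarch_normed_field"
  assumes f: "f \<longlonglongrightarrow> a" and g: "g \<longlonglongrightarrow> b"
  shows "(\<lambda>n. f n * g n) \<longlonglongrightarrow> a * b"
proof -
  define u v where "u = (\<lambda>n. vnorm (f n - a))" and "v = (\<lambda>n. vnorm (g n - b))"
  have uv: "u \<longlonglongrightarrow> 0" "v \<longlonglongrightarrow> 0"
    unfolding u_def v_def using iffD1[OF tendsto_vnorm_iff f] iffD1[OF tendsto_vnorm_iff g] .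
  have bound: "vnorm (f n * g n - a * b) \<le> u n * v n + vnorm a * v n + u n * vnorm b" for n
  proof -
    have "f n * g n - a * b = (f n - a) * (g n - b) + (a * (g n - b) + (f n - a) * b)"
      by (simp add: algebra_simps)
    then have "vnorm (f n * g n - a * b) \<le> max (u n * v n) (max (vnorm a * v n) (u n * vnorm b))"
      using vnorm_add[of "(f n - a) * (g n - b)" "a * (g n - b) + (f n - a) * b"]
        vnorm_add[of "a * (g n - b)" "(f n - a) * b"]
      by (simp add: u_def v_def vnorm_mult)
    moreover have "0 \<le> u n * v n" "0 \<le> vnorm a * v n" "0 \<le> u n * vnorm b"
      by (simp_all add: u_def v_def vnorm_nonneg)
    ultimately show ?thesis by linarith
  qed
  have "(\<lambda>n. u n * v n + vnorm a * v n + u n * vnorm b) \<longlonglongrightarrow> 0 * 0 + vnorm a * 0 + 0 * vnorm b"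
    by (intro tendsto_intros uv)
  then show ?thesis using bound by (intro tendsto_vnorm_bound) auto
qed

section \<open>Bounded power series\<close>

lemma bounded_fpsI: "(\<And>n. vnorm (fps_nth P n) \<le> C) \<Longrightarrow> P \<in> bounded_fps"
  unfolding bounded_fps_def by (force intro!: exI[of _ "C + 1"] intro: le_less_trans)

lemma bounded_fpsE:
  assumes "P \<in> bounded_fps"
  obtains C where "C > 0" "\<And>n. vnorm (fps_nth P n) \<le> C"
proof -
  obtain C where C: "\<And>n. vnorm (fps_nth P n) < C"
    using assms unfolding bounded_fps_def by blast
  have "C > 0" using C[of 0] vnorm_nonneg[of "fps_nth P 0"] by linarith
  then show ?thesis using that C less_imp_le by blast
qed

lemma bounded_fps_X_power: "(fps_X ^ k :: 'a::nonarch_normed_field fps) \<in> bounded_fps"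
  by (rule bounded_fpsI[of _ 1]) (simp add: fps_X_power_nth)

lemma vnorm_fps_mult_integral:
  fixes P Q :: "'a::nonarch_normed_field fps"
  assumes "\<And>n. vnorm (fps_nth P n) \<le> 1" "\<And>n. vnorm (fps_nth Q n) \<le> 1"
  shows "vnorm (fps_nth (P * Q) n) \<le> 1"
  unfolding fps_mult_nth
  by (rule vnorm_sum_le) (auto simp: vnorm_mult assms vnorm_nonneg intro: mult_le_one)

lemma vnorm_fps_power_integral:
  fixes P :: "'a::nonarch_normed_field fps"
  assumes "\<And>n. vnorm (fps_nth P n) \<le> 1"
  shows "vnorm (fps_nth (P ^ m) n) \<le> 1"
proof (induction m arbitrary: n)
  case (Suc m)
  then show ?case using vnorm_fps_mult_integral[OF assms Suc] by simp
qed (simp add: fps_one_nth)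

text \<open>Composition with \<open>H\<close> is triangular: coefficient \<open>n\<close> of
  \<open>P oo H\<close> is \<open>fps_nth P n\<close> times the \<open>n\<close>-th power of a unit,
  plus integral combinations of earlier coefficients of \<open>P\<close>. Hence one can solve for
  the coefficients of \<open>P\<close> recursively without leaving the integers.\<close>

lemma vnorm_fps_compose_integral_cancel:
  fixes P H :: "'a::nonarch_normed_field fps"
  assumes H0: "fps_nth H 0 = 0" and H1: "vnorm (fps_nth H 1) = 1"
    and H: "\<And>n. vnorm (fps_nth H n) \<le> 1"
    and PH: "\<And>n. vnorm (fps_nth (P oo H) n) \<le> 1"
  shows "vnorm (fps_nth P n) \<le> 1"
proof (induction n rule: less_induct)
  case (less n)
  define s where "s = (\<Sum>i=0..<n. fps_nth P i * fps_nth (H ^ i) n)"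
  have "fps_nth (P oo H) n = s + fps_nth P n * fps_nth H 1 ^ n"
    unfolding fps_compose_nth s_def
    by (subst sum.last_plus) (auto simp: startsby_zero_power_nth_same[OF H0] add.commute)
  then have "fps_nth P n * fps_nth H 1 ^ n = fps_nth (P oo H) n - s" by simp
  moreover have "vnorm s \<le> 1"
    unfolding s_def
    by (rule vnorm_sum_le)
       (auto simp: vnorm_mult less vnorm_nonneg vnorm_fps_power_integral[OF H] intro: mult_le_one)
  ultimately have "vnorm (fps_nth P n * fps_nth H 1 ^ n) \<le> 1"
    using vnorm_diff[of "fps_nth (P oo H) n" s] PH[of n] by simp
  then show ?case using H1 by (simp add: vnorm_mult vnorm_power)
qed

section \<open>Gauss norms of radius below 1\<close>

text \<open>All but finitely many values lie below \<open>u i\<close>, so the supremum is attained;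
  the least index attaining it gives the strict inequality.\<close>

lemma first_maximum_exists:
  fixes u :: "nat \<Rightarrow> real"
  assumes "u \<longlonglongrightarrow> 0" "u i > 0"
  obtains m where "\<And>n. u n \<le> u m" "\<And>n. n < m \<Longrightarrow> u n < u m"
proof -
  obtain N where N: "\<And>n. n \<ge> N \<Longrightarrow> u n < u i"
    using order_tendstoD(2)[OF assms] unfolding eventually_sequentially by blast
  define M where "M = Max (u ` {..N + i})"
  have "M \<in> u ` {..N + i}" unfolding M_def by (rule Max_in) auto
  then have ex: "\<exists>n. u n = M" by auto
  have ui: "u i \<le> M" unfolding M_def by (rule Max_ge) auto
  have le: "u n \<le> M" for n
  proof (cases "n \<le> N + i")
    case True
    then show ?thesis unfolding M_def by (intro Max_ge) auto
  next
    case False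
    then show ?thesis using N[of n] ui by simp
  qed
  define m where "m = (LEAST n. u n = M)"
  have "u m = M" unfolding m_def using ex by (rule LeastI_ex)
  moreover have "u n \<noteq> M" if "n < m" for n using not_less_Least that unfolding m_def by blast
  ultimately show ?thesis using that[of m] le by (simp add: order.not_eq_order_implies_strict)
qed

lemma bounded_fps_radius_tendsto_0:
  assumes "P \<in> bounded_fps" "0 \<le> r" "r < 1"
  shows "(\<lambda>n. vnorm (fps_nth P n) * r ^ n) \<longlonglongrightarrow> 0"
proof -
  obtain C where C: "\<And>n. vnorm (fps_nth P n) \<le> C" using bounded_fpsE[OF assms(1)] by blast
  have "(\<lambda>n. C * r ^ n) \<longlonglongrightarrow> 0"
    using assms by (intro tendsto_mult_right_zero LIMSEQ_power_zero) auto
  then show ?thesis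
    by (rule tendsto_sandwich[OF _ _ tendsto_const, rotated 2])
       (auto intro!: always_eventually mult_right_mono simp: C assms vnorm_nonneg)
qed

text \<open>
  The sup norm of a bounded series need not be attained, so the classical argument with the first
  coefficients of maximal norm is applied to the norms scaled by \<open>r ^ n\<close>, with \<open>r\<close> close to 1.
\<close>

lemma gauss_norm_mult_le:
  fixes A B :: "'a::nonarch_normed_field fps"
  assumes A: "A \<in> bounded_fps" and B: "B \<in> bounded_fps"
    and AB: "\<And>n. vnorm (fps_nth (A * B) n) \<le> C"
  shows "vnorm (fps_nth A i) * vnorm (fps_nth B j) \<le> C"
proof (rule ccontr)
  assume contra: "\<not> ?thesis"
  have C: "0 \<le> C" using AB[of 0] vnorm_nonneg order.trans by blast
  \<comment> \<open>If the bound failed, \<open>q r\<close> would tend to a limit above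
    \<open>C\<close> as \<open>r\<close> approaches 1 from the left, so some radius
    \<open>r < 1\<close> already violates the scaled bound.\<close>
  define q where "q = (\<lambda>r::real. (vnorm (fps_nth A i) * r ^ i) * (vnorm (fps_nth B j) * r ^ j))"
  have "(q \<longlongrightarrow> (vnorm (fps_nth A i) * 1 ^ i) * (vnorm (fps_nth B j) * 1 ^ j)) (at_left 1)"
    unfolding q_def by (intro tendsto_intros)
  then have "\<forall>\<^sub>F r in at_left 1. q r > C"
    using contra by (auto intro: order_tendstoD)
  moreover have "\<forall>\<^sub>F r::real in at_left 1. r \<in> {0<..<1}"
    by (rule eventually_at_left_real) simp
  ultimately have "\<forall>\<^sub>F r in at_left 1. q r > C \<and> r \<in> {0<..<1}"
    by eventually_elim simp
  then obtain r where r: "q r > C" "0 < r" "r < 1"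
    by (auto dest!: eventually_happens)
  define u v where "u = (\<lambda>n. vnorm (fps_nth A n) * r ^ n)" and "v = (\<lambda>n. vnorm (fps_nth B n) * r ^ n)"
  have nn: "0 \<le> u n" "0 \<le> v n" for n using r by (auto simp: u_def v_def vnorm_nonneg)
  have "u i * v j > 0" using r C unfolding q_def u_def v_def by linarith
  then have pos: "u i > 0" "v j > 0" using nn[of i] nn[of j] by (auto simp: zero_less_mult_iff)
  obtain k where k: "\<And>n. u n \<le> u k" "\<And>n. n < k \<Longrightarrow> u n < u k"
    using first_maximum_exists[of u i] bounded_fps_radius_tendsto_0[OF A] r pos u_def by auto
  obtain l where l: "\<And>n. v n \<le> v l" "\<And>n. n < l \<Longrightarrow> v n < v l"
    using first_maximum_exists[of v j] bounded_fps_radius_tendsto_0[OF B] r pos v_def by auto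
  have kl: "u k > 0" "v l > 0" using pos k(1)[of i] l(1)[of j] by auto
  define g where "g = (\<lambda>m. fps_nth A m * fps_nth B (k + l - m))"
  have scale: "vnorm (g m) * r ^ (k + l) = u m * v (k + l - m)" if "m \<le> k + l" for m
  proof -
    have "r ^ (k + l) = r ^ m * r ^ (k + l - m)" using that by (simp flip: power_add)
    then show ?thesis by (simp add: g_def u_def v_def vnorm_mult)
  qed
  \<comment> \<open>Among the summands \<open>g m\<close> of coefficient \<open>k + l\<close> of
    \<open>A * B\<close>, the one at \<open>k\<close> is strictly largest: for \<open>m < k\<close>
    the factor from \<open>A\<close> is strictly smaller, and for \<open>m > k\<close> the index
    \<open>k + l - m\<close> falls below \<open>l\<close>, so the factor from \<open>B\<close>
    is.\<close>
  have dom: "vnorm (g m) < vnorm (g k)" if "m \<le> k + l" "m \<noteq> k" for m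
  proof -
    have "u m * v (k + l - m) < u k * v l"
    proof (cases "m < k")
      case True
      then have "u m * v (k + l - m) \<le> u m * v l" using nn l(1) by (intro mult_left_mono)
      also have "\<dots> < u k * v l" using k(2)[OF True] kl by simp
      finally show ?thesis .
    next
      case False
      then have "k + l - m < l" using that by linarith
      then have "u k * v (k + l - m) < u k * v l" using l(2) kl by simp
      moreover have "u m * v (k + l - m) \<le> u k * v (k + l - m)"
        using nn k(1) by (intro mult_right_mono)
      ultimately show ?thesis by linarith
    qed
    then have "vnorm (g m) * r ^ (k + l) < vnorm (g k) * r ^ (k + l)"
      using scale[of m] scale[of k] that by simp
    then show ?thesis using r by (simp add: mult_less_cancel_right_pos)
  qed
  have gk: "vnorm (g k) * r ^ (k + l) = u k * v l" using scale[of k] by simp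
  then have gk0: "vnorm (g k) > 0"
    using kl r vnorm_nonneg[of "g k"] by (metis mult_eq_0_iff less_eq_real_def mult_pos_pos order_less_irrefl)
  have "fps_nth (A * B) (k + l) = g k + sum g ({0..k + l} - {k})"
    unfolding fps_mult_nth g_def by (subst sum.remove[of _ k]) auto
  moreover have "vnorm (sum g ({0..k + l} - {k})) < vnorm (g k)"
    by (rule vnorm_sum_less) (use dom gk0 in auto)
  ultimately have "vnorm (fps_nth (A * B) (k + l)) = vnorm (g k)"
    by (simp add: vnorm_add_dominant)
  \<comment> \<open>The chain \<open>q r = u i * v j \<le> u k * v l = vnorm (g k) * r ^ (k + l)
    \<le> vnorm (g k) \<le> C\<close> contradicts the choice of \<open>r\<close>.\<close>
  then have "vnorm (g k) \<le> C" using AB by metis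
  moreover have "vnorm (g k) * r ^ (k + l) \<le> vnorm (g k) * 1"
    using r gk0 by (intro mult_left_mono) (auto intro: power_le_one)
  moreover have "u i * v j \<le> u k * v l" using k(1) l(1) nn by (intro mult_mono) auto
  ultimately show False using r(1) gk unfolding q_def u_def v_def by linarith
qed

section \<open>The functional attached to a moment sequence\<close>

text \<open>This is umbral substitution into \<open>P\<close> of a symbol whose \<open>k\<close>-th
  moment is \<open>a k\<close>; for \<open>a k = c ^ k\<close> it is the ordinary value of
  \<open>P\<close> at \<open>c\<close>.\<close>

definition moment_functional :: "(nat \<Rightarrow> 'a::nonarch_normed_field) \<Rightarrow> 'a fps \<Rightarrow> 'a" where
  "moment_functional a P = suminf (\<lambda>k. a k * fps_nth P k)"

lemma hasse_series_nth_0: "fps_nth (hasse_series a P) 0 = moment_functional a P"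
  by (simp add: hasse_series_def hasse_deriv_def moment_functional_def)

lemma moment_functional_X_power: "moment_functional a (fps_X ^ k) = a k"
proof -
  have "(\<lambda>i. a i * fps_nth (fps_X ^ k) i) = (\<lambda>i. if i = k then a i else 0)"
    by (auto simp: fps_X_power_nth)
  moreover have "(\<lambda>i. if i = k then a i else 0) sums a k"
    by (rule sums_single)
  ultimately show ?thesis
    unfolding moment_functional_def by (metis sums_unique)
qed

lemma moment_functional_sums:
  fixes c :: "'a::{nonarch_normed_field, complete_space}"
  assumes "vnorm c < 1" "P \<in> bounded_fps"
  shows "(\<lambda>k. c ^ k * fps_nth P k) sums moment_functional (\<lambda>k. c ^ k) P"
proof -
  have "(\<lambda>k. vnorm (fps_nth P k) * vnorm c ^ k) \<longlonglongrightarrow> 0"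
    using assms by (intro bounded_fps_radius_tendsto_0) (auto simp: vnorm_nonneg)
  then have "(\<lambda>k. c ^ k * fps_nth P k) \<longlonglongrightarrow> 0"
    by (intro iffD2[OF tendsto_vnorm_iff]) (simp add: vnorm_mult vnorm_power mult.commute)
  then show ?thesis
    unfolding moment_functional_def by (intro summable_sums nonarch_summable)
qed

text \<open>The product of the \<open>n\<close>-th partial sums differs from the \<open>n\<close>-th
  partial sum of the product only by terms with \<open>i + j \<ge> n\<close>. Each is at most
  \<open>B * C * vnorm c ^ n\<close>, and so is their sum by the ultrametric inequality.\<close>

lemma moment_functional_power_mult:
  fixes c :: "'a::{nonarch_normed_field, complete_space}"
  assumes c: "vnorm c < 1" and P: "P \<in> bounded_fps" and Q: "Q \<in> bounded_fps"
    and PQ: "P * Q \<in> bounded_fps"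
  shows "moment_functional (\<lambda>k. c ^ k) (P * Q) =
         moment_functional (\<lambda>k. c ^ k) P * moment_functional (\<lambda>k. c ^ k) Q"
proof -
  define S where "S = (\<lambda>P n. \<Sum>k<n. c ^ k * fps_nth P k)"
  have S: "S R \<longlonglongrightarrow> moment_functional (\<lambda>k. c ^ k) R" if "R \<in> bounded_fps" for R
    using moment_functional_sums[OF c that] unfolding S_def sums_def .
  obtain B where B: "B > 0" "\<And>n. vnorm (fps_nth P n) \<le> B" using bounded_fpsE[OF P] by blast
  obtain C where C: "C > 0" "\<And>n. vnorm (fps_nth Q n) \<le> C" using bounded_fpsE[OF Q] by blast
  define t where "t = (\<lambda>(i, j). (c ^ i * fps_nth P i) * (c ^ j * fps_nth Q j))"
  have diff: "S P n * S Q n - S (P * Q) n = sum t ({..<n} \<times> {..<n} - {(i, j). i + j < n})" for n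
  proof -
    have "S P n * S Q n = sum t ({..<n} \<times> {..<n})"
      unfolding S_def t_def sum_product sum.cartesian_product by simp
    moreover have "S (P * Q) n = sum t {(i, j). i + j < n}"
    proof -
      have "S (P * Q) n = (\<Sum>k<n. \<Sum>i\<le>k. t (i, k - i))"
        unfolding S_def t_def fps_mult_nth sum_distrib_left atLeast0AtMost
        by (intro sum.cong refl) (auto simp: algebra_simps simp flip: power_add)
      also have "\<dots> = sum t {(i, j). i + j < n}"
        using sum.triangle_reindex[of "\<lambda>i j. t (i, j)" n] by (simp add: case_prod_eta)
      finally show ?thesis .
    qed
    moreover have "{(i, j). i + j < n} \<subseteq> {..<n} \<times> {..<n}" by auto
    ultimately show ?thesis by (simp add: sum_diff)
  qed
  have bound: "vnorm (S P n * S Q n - S (P * Q) n) \<le> B * C * vnorm c ^ n" for n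
    unfolding diff
  proof (rule vnorm_sum_le)
    fix z assume z: "z \<in> {..<n} \<times> {..<n} - {(i, j). i + j < n}"
    obtain i j where ij: "z = (i, j)" "n \<le> i + j" using z by (cases z) auto
    have "vnorm (t z) = (vnorm (fps_nth P i) * vnorm (fps_nth Q j)) * vnorm c ^ (i + j)"
      by (simp add: t_def ij vnorm_mult vnorm_power power_add)
    also have "\<dots> \<le> (B * C) * vnorm c ^ n"
      using B C c ij by (intro mult_mono power_decreasing) (auto simp: vnorm_nonneg)
    finally show "vnorm (t z) \<le> B * C * vnorm c ^ n" .
  qed (use B C in \<open>simp add: vnorm_nonneg\<close>)
  let ?L = "moment_functional (\<lambda>k. c ^ k) (P * Q)"
  have "(\<lambda>n. B * C * vnorm c ^ n) \<longlonglongrightarrow> 0"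
    using c by (intro tendsto_mult_right_zero LIMSEQ_power_zero) (simp add: vnorm_nonneg)
  then have "(\<lambda>n. B * C * vnorm c ^ n + vnorm (S (P * Q) n - ?L)) \<longlonglongrightarrow> 0 + 0"
    by (intro tendsto_add iffD1[OF tendsto_vnorm_iff S[OF PQ]])
  moreover have "vnorm (S P n * S Q n - ?L) \<le> B * C * vnorm c ^ n + vnorm (S (P * Q) n - ?L)" for n
    using dist_triangle[of "S P n * S Q n" ?L "S (P * Q) n"] bound[of n] by (simp add: dist_vnorm)
  ultimately have "(\<lambda>n. S P n * S Q n) \<longlonglongrightarrow> ?L"
    by (intro tendsto_vnorm_bound) auto
  then show ?thesis
    using nonarch_tendsto_mult[OF S[OF P] S[OF Q]] LIMSEQ_unique by blast
qed

lemma moment_functional_power_power: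
  fixes c :: "'a::{nonarch_normed_field, complete_space}"
  assumes c: "vnorm c < 1" and P: "\<And>k. P ^ k \<in> bounded_fps"
  shows "moment_functional (\<lambda>k. c ^ k) (P ^ k) = moment_functional (\<lambda>k. c ^ k) P ^ k"
proof (induction k)
  case 0
  then show ?case using moment_functional_X_power[of "\<lambda>k. c ^ k" 0] by simp
next
  case (Suc k)
  then show ?case
    using moment_functional_power_mult[OF c, of P "P ^ k"] P[of 1] P[of k] P[of "Suc k"] by simp
qed

section \<open>Isomorphisms preserving boundedness\<close>

lemma fps_algebra_iso_power:
  assumes "fps_algebra_iso \<phi>"
  shows "\<phi> (P ^ k) = \<phi> P ^ k"
proof (induction k)
  case 0
  have "\<phi> (fps_const 1) = fps_const 1" using assms unfolding fps_algebra_iso_def by blast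
  then show ?case by simp
next
  case (Suc k)
  then show ?case using assms unfolding fps_algebra_iso_def by simp
qed

text \<open>A power of a positive characteristic is never 0, so 0 is not among the exponents allowed
  in \<open>\<phi> fps_X\<close>.\<close>

lemma additive_iso_X_nth_0:
  fixes \<phi> :: "'a::nonarch_normed_field fps \<Rightarrow> 'a fps"
  assumes "CHAR('a) > 0" "additive_iso \<phi>"
  shows "fps_nth (\<phi> fps_X) 0 = 0"
  using assms unfolding additive_iso_def by (metis power_eq_0_iff less_numeral_extra(3))

text \<open>This removes the outer \<open>\<phi>\<close> when constant coefficients are compared in
  the intertwining relation.\<close>

lemma additive_iso_nth_0:
  fixes \<phi> :: "'a::nonarch_normed_field fps \<Rightarrow> 'a fps"
  assumes "additive_iso \<phi>"
  shows "fps_nth (\<phi> P) 0 = fps_nth P 0"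
proof -
  have "\<phi> P = P oo \<phi> fps_X" using assms unfolding additive_iso_def by blast
  then show ?thesis by simp
qed

lemma integer_units_vnorm:
  assumes "x \<in> integer_units"
  shows "vnorm x = 1"
proof -
  obtain y where "vnorm x \<le> 1" "vnorm y \<le> 1" "x * y = 1"
    using assms unfolding integer_units_def integer_ring_def by blast
  then have "vnorm x * vnorm y = 1" by (metis vnorm_mult vnorm_one)
  with \<open>vnorm x \<le> 1\<close> \<open>vnorm y \<le> 1\<close> show ?thesis
    by (smt (verit) mult_left_le vnorm_nonneg)
qed

lemma additive_iso_X_integral:
  fixes \<phi> :: "'a::nonarch_normed_field fps \<Rightarrow> 'a fps"
  assumes char: "CHAR('a) > 0" and \<phi>: "additive_iso \<phi>"
    and bdd: "\<And>P. P \<in> bounded_fps \<Longrightarrow> \<phi> P \<in> bounded_fps"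
  shows "vnorm (fps_nth (\<phi> fps_X) n) \<le> 1"
proof (cases "n = 0")
  case True
  then show ?thesis using additive_iso_X_nth_0[OF char \<phi>] by simp
next
  case False
  \<comment> \<open>The geometric series, inverse to \<open>1 - fps_X\<close>.\<close>
  define E :: "'a fps" where "E = Abs_fps (\<lambda>_. 1)"
  have E: "E \<in> bounded_fps" by (rule bounded_fpsI[of _ 1]) (simp add: E_def)
  have X: "(1 - fps_X :: 'a fps) \<in> bounded_fps"
    by (rule bounded_fpsI[of _ 1]) (simp add: fps_X_def fps_one_nth)
  have iso: "fps_algebra_iso \<phi>" using \<phi> unfolding additive_iso_def by blast
  have add: "\<phi> (P + Q) = \<phi> P + \<phi> Q" and mult: "\<phi> (P * Q) = \<phi> P * \<phi> Q" for P Q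
    using iso unfolding fps_algebra_iso_def by blast+
  have one: "\<phi> 1 = 1" using fps_algebra_iso_power[OF iso, of 0 0] by simp
  have minus: "\<phi> (1 - fps_X) = 1 - \<phi> fps_X"
    using add[of "1 - fps_X" fps_X] one by (simp add: algebra_simps)
  have "(1 - fps_X) * E = 1"
    by (rule fps_ext) (auto simp: E_def left_diff_distrib fps_one_nth)
  then have "\<phi> (1 - fps_X) * \<phi> E = 1" using mult[of "1 - fps_X" E] one by simp
  \<comment> \<open>Coefficient \<open>n\<close> is paired with the constant coefficient of
    \<open>\<phi> E\<close>, which is 1, so the bound for the product 1 isolates it. As
    \<open>n\<close> is nonzero, it is minus coefficient \<open>n\<close> of
    \<open>\<phi> fps_X\<close>.\<close>
  then have "vnorm (fps_nth (\<phi> (1 - fps_X)) n) * vnorm (fps_nth (\<phi> E) 0) \<le> 1"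
    by (intro gauss_norm_mult_le bdd E X) (simp add: fps_one_nth)
  moreover have "fps_nth (\<phi> E) 0 = 1" by (simp add: additive_iso_nth_0[OF \<phi>] E_def)
  ultimately show ?thesis using False by (simp add: minus fps_one_nth)
qed

lemma additive_iso_X_power_preimage_bounded:
  fixes \<phi> :: "'a::nonarch_normed_field fps \<Rightarrow> 'a fps"
  assumes char: "CHAR('a) > 0" and \<phi>: "additive_iso \<phi>"
    and bdd: "\<And>P. P \<in> bounded_fps \<Longrightarrow> \<phi> P \<in> bounded_fps"
    and P: "\<phi> P = fps_X ^ k"
  shows "P \<in> bounded_fps"
proof (rule bounded_fpsI)
  fix n
  have "\<phi> P = P oo \<phi> fps_X" using \<phi> unfolding additive_iso_def by blast
  then have PH: "P oo \<phi> fps_X = fps_X ^ k" using P by (rule subst)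
  have "fps_nth (\<phi> fps_X) 1 \<in> integer_units" using \<phi> unfolding additive_iso_def by blast
  then have H1: "vnorm (fps_nth (\<phi> fps_X) 1) = 1" by (rule integer_units_vnorm)
  show "vnorm (fps_nth P n) \<le> 1"
  proof (rule vnorm_fps_compose_integral_cancel[OF additive_iso_X_nth_0[OF char \<phi>] H1])
    show "vnorm (fps_nth (\<phi> fps_X) m) \<le> 1" for m
      using char \<phi> bdd by (rule additive_iso_X_integral)
    show "vnorm (fps_nth (P oo \<phi> fps_X) m) \<le> 1" for m
      unfolding PH by (simp add: fps_X_power_nth)
  qed
qed

section \<open>Exponential flows and geometric moments\<close>

theorem theorem5p7:
  fixes ev :: "('u, 'a::{nonarch_normed_field, complete_space}) umbral_poly \<Rightarrow> 'a fps"
    and \<F> \<F>h :: "'a \<Rightarrow> 'u"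
    and \<phi> :: "'a fps \<Rightarrow> 'a fps"
    and x :: 'a
  assumes "CHAR('a) > 0"
    and "umbral_calculus ev"
    and "flow_dual_via ev \<phi> \<F> \<F>h"
    and "\<forall>y \<in> flow_domain ev \<F> \<inter> flow_domain ev \<F>h. \<forall>P \<in> bounded_fps.
           flow_map ev \<F>h y P = \<phi> (flow_map ev \<F> y (inv \<phi> P))"
    and "x \<in> flow_domain ev \<F> \<inter> flow_domain ev \<F>h \<inter>
               {y. vnorm (umbral_moment ev \<F>h 1 y) < 1}"
  shows "(\<forall>P \<in> bounded_fps. exp_hasse (umbral_moment ev \<F>h 1 x) P = flow_map ev \<F>h x P)
           \<longleftrightarrow> geometric_at ev \<F> x"
proof -
  define a where "a = (\<lambda>k. umbral_moment ev \<F> k x)"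
  define b where "b = (\<lambda>k. umbral_moment ev \<F>h k x)"
  have \<phi>: "additive_iso \<phi>" using assms(3) unfolding flow_dual_via_def by blast
  then have iso: "fps_algebra_iso \<phi>" unfolding additive_iso_def by blast
  have bdd: "\<phi> P \<in> bounded_fps" if "P \<in> bounded_fps" for P
    using assms(3,5) that unfolding flow_dual_via_def by blast
  have dual: "moment_functional a P = moment_functional b (\<phi> P)" if "P \<in> bounded_fps" for P
  proof -
    have "\<phi> (flow_map ev \<F> x P) = flow_map ev \<F>h x (\<phi> P)"
      using assms(3,5) that unfolding flow_dual_via_def by blast
    then have "fps_nth (hasse_series a P) 0 = fps_nth (hasse_series b (\<phi> P)) 0"
      using additive_iso_nth_0[OF \<phi>] unfolding flow_map_def a_def b_def by metis
    then show ?thesis by (simp add: hasse_series_nth_0)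
  qed
  have "(\<forall>P \<in> bounded_fps. exp_hasse (b 1) P = hasse_series b P) \<longleftrightarrow> (\<forall>k. a k = a 1 ^ k)"
  proof
    assume exp: "\<forall>P \<in> bounded_fps. exp_hasse (b 1) P = hasse_series b P"
    \<comment> \<open>The constant coefficients of the images of \<open>fps_X ^ k\<close> recover
      the moments from the operator.\<close>
    have "b = (\<lambda>k. b 1 ^ k)"
    proof
      fix k
      have "moment_functional (\<lambda>k. b 1 ^ k) (fps_X ^ k) = moment_functional b (fps_X ^ k)"
        using bspec[OF exp bounded_fps_X_power, of k]
        unfolding exp_hasse_def by (simp flip: hasse_series_nth_0)
      then show "b k = b 1 ^ k" by (simp add: moment_functional_X_power)
    qed
    then have bL: "moment_functional b = moment_functional (\<lambda>k. b 1 ^ k)" by (rule arg_cong)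
    have b1: "vnorm (b 1) < 1" using assms(5) unfolding b_def by blast
    \<comment> \<open>Thus \<open>a k\<close> is the value of \<open>\<phi> fps_X ^ k\<close> at
      \<open>b 1\<close>, hence a \<open>k\<close>-th power; the case \<open>k = 1\<close>
      identifies the base as \<open>a 1\<close>.\<close>
    have a: "a k = moment_functional (\<lambda>k. b 1 ^ k) (\<phi> fps_X ^ k)" for k
      using dual[OF bounded_fps_X_power, of k] unfolding bL
      by (simp add: moment_functional_X_power fps_algebra_iso_power[OF iso])
    have "\<phi> fps_X ^ k \<in> bounded_fps" for k
      using bdd[OF bounded_fps_X_power, of k] by (simp add: fps_algebra_iso_power[OF iso])
    then show "\<forall>k. a k = a 1 ^ k"
      using moment_functional_power_power[OF b1] a by simp
  next
    assume geo: "\<forall>k. a k = a 1 ^ k"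
    \<comment> \<open>A geometric sequence tending to 0 has ratio of norm below 1, which makes
      evaluation at \<open>a 1\<close> available.\<close>
    have "a \<longlonglongrightarrow> 0" using assms(5) unfolding a_def flow_domain_def by blast
    then have "(\<lambda>k. vnorm (a k - 0)) \<longlonglongrightarrow> 0" by (rule iffD1[OF tendsto_vnorm_iff])
    moreover have "(\<lambda>k. vnorm (a k - 0)) = (\<lambda>k. vnorm (a 1) ^ k)"
    proof
      fix k
      show "vnorm (a k - 0) = vnorm (a 1) ^ k"
        by (subst geo[rule_format]) (simp add: vnorm_power)
    qed
    ultimately have "(\<lambda>k. vnorm (a 1) ^ k) \<longlonglongrightarrow> 0" by simp
    then have "\<forall>\<^sub>F k in sequentially. vnorm (a 1) ^ k < 1" by (rule order_tendstoD) simp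
    then obtain k where "vnorm (a 1) ^ k < 1" unfolding eventually_sequentially by blast
    then have a1: "vnorm (a 1) < 1" using one_le_power[of "vnorm (a 1)" k] by linarith
    have "a = (\<lambda>k. a 1 ^ k)" by (rule ext) (rule geo[rule_format])
    then have aL: "moment_functional a = moment_functional (\<lambda>k. a 1 ^ k)" by (rule arg_cong)
    \<comment> \<open>\<open>K\<close> is the composition inverse of \<open>\<phi> fps_X\<close>,
      and its powers are the preimages of the powers of \<open>fps_X\<close>.\<close>
    define K where "K = inv \<phi> fps_X"
    have "surj \<phi>" using iso unfolding fps_algebra_iso_def by (simp add: bij_is_surj)
    then have K: "\<phi> (K ^ k) = fps_X ^ k" for k
      by (simp add: K_def fps_algebra_iso_power[OF iso] surj_f_inv_f)
    have Kb: "K ^ k \<in> bounded_fps" for k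
      using additive_iso_X_power_preimage_bounded[OF assms(1) \<phi> bdd K] .
    \<comment> \<open>Each \<open>b k\<close> is the value of \<open>K ^ k\<close> at
      \<open>a 1\<close>; in particular \<open>b 1\<close> is the value of \<open>K\<close>.\<close>
    have "b k = moment_functional (\<lambda>k. a 1 ^ k) (K ^ k)" for k
      using dual[OF Kb, of k] unfolding aL K by (simp add: moment_functional_X_power)
    then have "b k = b 1 ^ k" for k
      using moment_functional_power_power[OF a1 Kb] by simp
    then have "b = (\<lambda>k. b 1 ^ k)" by (rule ext)
    then have "hasse_series b = exp_hasse (b 1)" unfolding exp_hasse_def by (rule arg_cong)
    then show "\<forall>P \<in> bounded_fps. exp_hasse (b 1) P = hasse_series b P" by simp
  qed
  then show ?thesis
    unfolding geometric_at_def flow_map_def a_def b_def .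
qed

end
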